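(* Let $\mathcal{X}$ be a probability distribution on $\{0,1,2,\dots\}$ with $\mathbb{E}(\mathcal{X})>1$ and $\mathcal{X}(0)>0$, and let $q\in(0,1)$ be the extinction probability of the Galton-Watson process with offspring $\mathcal{X}$ started from one individual. For $N\ge 2$ let $(X^N_k)_{k\ge 0}$ be the Galton-Watson process with offspring $\mathcal{X}$ censored at level $N$, and let $U_N=\min\{k\ge 0 : X^N_k=0\}$. Then, as $N\to\infty$, $U_N q^N$ converges in law to the exponential distribution with parameter $1$. The convergence also holds in mean: $\mathbb{E}(U_N)\sim (1/q)^N$ as $N\to\infty$, i.e. $\lim_{N\to\infty} q^N\,\mathbb{E}(U_N)=1$.
   Context: $\mathcal{X}(i)$ denotes the mass that $\mathcal{X}$ gives to $i$, and $\mathbb{E}(\mathcal{X})=\sum_i i\,\mathcal{X}(i)\in[0,\infty]$ (possibly infinite). The (uncensored) Galton-Watson process with offspring $\mathcal{X}$ started from one individual is $Z_0=1$, $Z_{k+1}=\sum_{i=1}^{Z_k}X_{k,i}$ with $X_{k,i}$ i.i.d. of law $\mathcal{X}$ (and $Z_{k+1}=0$ if $Z_k=0$); $q$ is the probability that $Z_k=0$ for some $k$, equivalently the unique solution in $(0,1)$ of $\sum_{i\ge 0}\mathcal{X}(i)x^i=x$. The Galton-Watson process censored at level $N$ with offspring $\mathcal{X}$ is the process defined by $X^N_0=N$ and, for $k\ge 0$, $X^N_{k+1}=\min\left(N,\sum_{i=1}^{X^N_k}X_{k,i}\right)$ if $X^N_k>0$ and $X^N_{k+1}=0$ otherwise,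 where the $X_{k,i}$ are i.i.d. of law $\mathcal{X}$. *)

theory Defs
  imports "HOL-Probability.Probability"
begin

(* The index i = 0 is never used, so nothing is required of it. *)
definition iid_offspring :: "'w measure \<Rightarrow> nat pmf \<Rightarrow> (nat \<Rightarrow> nat \<Rightarrow> 'w \<Rightarrow> nat) \<Rightarrow> bool" where
  "iid_offspring M p \<xi> \<longleftrightarrow>
     prob_space M \<and>
     prob_space.indep_vars M (\<lambda>_. count_space UNIV) (\<lambda>(k, i). \<xi> k i) (UNIV \<times> {1..}) \<and>
     (\<forall>k. \<forall>i\<ge>1. distr M (count_space UNIV) (\<xi> k i) = measure_pmf p)"

(* In both processes the empty sum makes 0 absorbing. *)
primrec galton_watson :: "(nat \<Rightarrow> nat \<Rightarrow> 'w \<Rightarrow> nat) \<Rightarrow> nat \<Rightarrow> 'w \<Rightarrow> nat" where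
  "galton_watson \<xi> 0 \<omega> = 1"
| "galton_watson \<xi> (Suc k) \<omega> = (\<Sum>i = 1..galton_watson \<xi> k \<omega>. \<xi> k i \<omega>)"

definition extinction_probability :: "'w measure \<Rightarrow> (nat \<Rightarrow> nat \<Rightarrow> 'w \<Rightarrow> nat) \<Rightarrow> real" where
  "extinction_probability M \<xi> = measure M {\<omega> \<in> space M. \<exists>k. galton_watson \<xi> k \<omega> = 0}"

primrec censored_gw :: "nat \<Rightarrow> (nat \<Rightarrow> nat \<Rightarrow> 'w \<Rightarrow> nat) \<Rightarrow> nat \<Rightarrow> 'w \<Rightarrow> nat" where
  "censored_gw N \<xi> 0 \<omega> = N"
| "censored_gw N \<xi> (Suc k) \<omega> = min N (\<Sum>i = 1..censored_gw N \<xi> k \<omega>. \<xi> k i \<omega>)"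

(* Equal to \<infinity> if the process never reaches 0, since Inf {} = \<infinity> in enat. *)
definition censored_extinction_time :: "nat \<Rightarrow> (nat \<Rightarrow> nat \<Rightarrow> 'w \<Rightarrow> nat) \<Rightarrow> 'w \<Rightarrow> enat" where
  "censored_extinction_time N \<xi> \<omega> = Inf (enat ` {k. censored_gw N \<xi> k \<omega> = 0})"

(* The real number U q^N is formed with enn2real, which sends \<infinity> to 0. This is immaterial
   for U almost surely finite, in particular whenever U has finite mean. The mean itself
   is a nonnegative integral in ennreal that counts the value \<infinity>. *)
definition scaled_extinction_law :: "'w measure \<Rightarrow> nat \<Rightarrow> (nat \<Rightarrow> nat \<Rightarrow> 'w \<Rightarrow> nat) \<Rightarrow> real \<Rightarrow> real measure" where
  "scaled_extinction_law M N \<xi> q =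
     distr M borel (\<lambda>\<omega>. enn2real (ennreal_of_enat (censored_extinction_time N \<xi> \<omega>)) * q ^ N)"

definition mean_extinction_time :: "'w measure \<Rightarrow> nat \<Rightarrow> (nat \<Rightarrow> nat \<Rightarrow> 'w \<Rightarrow> nat) \<Rightarrow> ennreal" where
  "mean_extinction_time M N \<xi> = (\<integral>\<^sup>+ \<omega>. ennreal_of_enat (censored_extinction_time N \<xi> \<omega>) \<partial>M)"

end

theory Submission imports Defs begin

text \<open>For the uncensored process \<open>1 - q ^ x\<close> is harmonic and vanishes at 0. Censoring changes it little:
  \<open>1 - q ^ min N s \<ge> (1 - q ^ N) * (1 - q ^ s)\<close> shows that it loses at most the proportion \<open>q ^ N\<close> in one
  step of the censored chain, so that \<open>P(U > k) \<ge> (1 - q ^ N) ^ (k + 1)\<close>. Conversely, a small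
  perturbation of it loses at least the proportion \<open>(1 - \<epsilon>) * q ^ N\<close> in one step, and \<open>P(U > j)\<close>
  for the chain started from \<open>x\<close> is at most \<open>1 - u\<^sub>j ^ x\<close>, where the \<open>j\<close>-th iterate \<open>u\<^sub>j\<close> of the
  generating function at 0 tends to \<open>q\<close>. Hence
  \<open>P(U > k + j) \<le> (1 + \<epsilon>) * (1 - (1 - \<epsilon>) * q ^ N) ^ k\<close> for large \<open>N\<close>. These two geometric bounds on
  the tail of \<open>U\<close> give both limits.\<close>

subsection \<open>Processes driven by a family of offspring variables\<close>

definition pgf :: "nat pmf \<Rightarrow> real \<Rightarrow> real" where
  "pgf p u = measure_pmf.expectation p (\<lambda>i. u ^ i)"

text \<open>A common recursion for both processes, so that measurability and the Markov property are
  proved once: \<open>c\<close> is the identity for the Galton-Watson process and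
  \<open>min N\<close> for the censored one.\<close>

primrec branching :: "(nat \<Rightarrow> nat) \<Rightarrow> nat \<Rightarrow> (nat \<Rightarrow> nat \<Rightarrow> 'w \<Rightarrow> nat) \<Rightarrow> nat \<Rightarrow> 'w \<Rightarrow> nat" where
  "branching c z \<xi> 0 \<omega> = z"
| "branching c z \<xi> (Suc k) \<omega> = c (\<Sum>i = 1..branching c z \<xi> k \<omega>. \<xi> k i \<omega>)"

lemma galton_watson_eq_branching: "galton_watson \<xi> k \<omega> = branching (\<lambda>s. s) 1 \<xi> k \<omega>"
  by (induction k) auto

lemma censored_gw_eq_branching: "censored_gw N \<xi> k \<omega> = branching (min N) N \<xi> k \<omega>"
  by (induction k) auto

lemma measurable_sum_nat:
  assumes "\<And>i. i \<in> A \<Longrightarrow> f i \<in> measurable M (count_space (UNIV :: nat set))"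
  shows "(\<lambda>\<omega>. \<Sum>i\<in>A. f i \<omega>) \<in> measurable M (count_space UNIV)"
  using assms
proof (induction A rule: infinite_finite_induct)
  case (insert a A)
  have [measurable]: "f a \<in> measurable M (count_space UNIV)"
      "(\<lambda>\<omega>. \<Sum>i\<in>A. f i \<omega>) \<in> measurable M (count_space UNIV)"
    using insert by auto
  have "(\<lambda>\<omega>. f a \<omega> + (\<Sum>i\<in>A. f i \<omega>)) \<in> measurable M (count_space UNIV)"
    by measurable
  with insert show ?case by simp
qed auto

lemma measurable_branching:
  assumes "\<And>j i. j < k \<Longrightarrow> i \<ge> 1 \<Longrightarrow> \<xi> j i \<in> measurable M (count_space UNIV)"
  shows "branching c z \<xi> k \<in> measurable M (count_space UNIV)"
  using assms
proof (induction k)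
  case (Suc k)
  have [measurable]: "branching c z \<xi> k \<in> measurable M (count_space UNIV)"
    using Suc by simp
  have [measurable]: "(\<lambda>\<omega>. c (\<Sum>i = 1..x. \<xi> k i \<omega>)) \<in> measurable M (count_space UNIV)" for x
  proof -
    have [measurable]: "(\<lambda>\<omega>. \<Sum>i = 1..x. \<xi> k i \<omega>) \<in> measurable M (count_space UNIV)"
      using Suc.prems by (intro measurable_sum_nat) auto
    show ?thesis by measurable
  qed
  have "(\<lambda>\<omega>. c (\<Sum>i = 1..branching c z \<xi> k \<omega>. \<xi> k i \<omega>)) \<in> measurable M (count_space UNIV)"
    by (rule measurable_compose_countable[where g = "branching c z \<xi> k"
          and f = "\<lambda>x \<omega>. c (\<Sum>i = 1..x. \<xi> k i \<omega>)"]) measurable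
  then show ?case
    by (simp cong: measurable_cong)
qed (simp cong: measurable_cong)

text \<open>The two families may live on different sample spaces. Below, one of them is the
  coordinate family on a product space, which exhibits the state at time \<open>k\<close> as a
  function of the earlier rows.\<close>

lemma branching_depends_on_past:
  assumes "\<And>j i. j < k \<Longrightarrow> i \<ge> 1 \<Longrightarrow> \<xi> j i \<omega> = \<xi>' j i \<omega>'"
  shows "branching c z \<xi> k \<omega> = branching c z \<xi>' k \<omega>'"
  using assms
proof (induction k)
  case (Suc k)
  have "branching c z \<xi> k \<omega> = branching c z \<xi>' k \<omega>'"
    using Suc by simp
  then show ?case
    by (auto intro!: arg_cong[where f = c] sum.cong Suc.prems)
qed simp

section \<open>Independent offspring and the Markov property\<close>

locale offspring_family =
  fixes M :: "'w measure" and p :: "nat pmf" and \<xi> :: "nat \<Rightarrow> nat \<Rightarrow> 'w \<Rightarrow> nat"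
  assumes iid: "iid_offspring M p \<xi>"

sublocale offspring_family \<subseteq> prob_space M
  using iid by (simp add: iid_offspring_def)

context offspring_family
begin

lemma indep_offspring:
  "indep_vars (\<lambda>_. count_space UNIV) (\<lambda>(k, i). \<xi> k i) (UNIV \<times> {1..})"
  using iid by (simp add: iid_offspring_def)

lemma distr_offspring: "i \<ge> 1 \<Longrightarrow> distr M (count_space UNIV) (\<xi> k i) = measure_pmf p"
  using iid by (simp add: iid_offspring_def)

lemma measurable_offspring: "i \<ge> 1 \<Longrightarrow> \<xi> k i \<in> measurable M (count_space UNIV)"
  using indep_offspring unfolding indep_vars_def by fastforce

text \<open>The number \<open>x\<close> of parents is a constant here, so this variable depends on
  row \<open>k\<close> alone; its law is the transition kernel before \<open>c\<close> is
  applied.\<close>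

definition generation :: "nat \<Rightarrow> nat \<Rightarrow> 'w \<Rightarrow> nat" where
  "generation k x \<omega> = (\<Sum>i = 1..x. \<xi> k i \<omega>)"

lemma measurable_generation[measurable]: "generation k x \<in> measurable M (count_space UNIV)"
  unfolding generation_def[abs_def]
  by (intro measurable_sum_nat measurable_offspring) auto

lemma measurable_branching_offspring[measurable]:
  "branching c z \<xi> k \<in> measurable M (count_space UNIV)"
  by (intro measurable_branching measurable_offspring)

lemma integrable_bounded_nat:
  fixes g :: "nat \<Rightarrow> real"
  assumes [measurable]: "Y \<in> measurable M (count_space UNIV)" and "\<And>x. \<bar>g x\<bar> \<le> B"
  shows "integrable M (\<lambda>\<omega>. g (Y \<omega>))"
  using assms(2) by (intro integrable_const_bound[where B = B]) auto

text \<open>The power turns the sum into a product of independent factors, each of mean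
  \<open>pgf p u\<close>. The later kernel estimates rest on this formula.\<close>

lemma expectation_power_generation:
  assumes "0 \<le> u" "u \<le> 1"
  shows "expectation (\<lambda>\<omega>. u ^ generation k x \<omega>) = pgf p u ^ x"
proof -
  have ind: "indep_vars (\<lambda>_. borel) (\<lambda>(k, i) \<omega>. u ^ \<xi> k i \<omega>) ({k} \<times> {1..x})"
    using indep_vars_compose2[OF indep_vars_subset[OF indep_offspring, of "{k} \<times> {1..x}"],
        of "\<lambda>_ n. u ^ n" "\<lambda>_. borel"]
    by (simp add: case_prod_unfold Sigma_mono)
  have E: "expectation (\<lambda>\<omega>. u ^ \<xi> k i \<omega>) = pgf p u" if "i \<ge> 1" for i
    unfolding pgf_def distr_offspring[OF that, of k, symmetric]
    using measurable_offspring[OF that] by (subst integral_distr) auto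
  have int: "integrable M (\<lambda>\<omega>. u ^ \<xi> k i \<omega>)" if "i \<ge> 1" for i
    using integrable_bounded_nat[OF measurable_offspring[OF that], of "\<lambda>n. u ^ n" 1] assms
    by (auto simp: power_le_one)
  have "expectation (\<lambda>\<omega>. u ^ generation k x \<omega>)
      = expectation (\<lambda>\<omega>. \<Prod>j\<in>{k} \<times> {1..x}. (\<lambda>(k, i) \<omega>. u ^ \<xi> k i \<omega>) j \<omega>)"
  proof -
    have "{k} \<times> {1..x} = Pair k ` {1..x}"
      by auto
    then show ?thesis
      by (simp add: generation_def power_sum prod.reindex inj_on_def)
  qed
  also have "\<dots> = (\<Prod>j\<in>{k} \<times> {1..x}. expectation ((\<lambda>(k, i) \<omega>. u ^ \<xi> k i \<omega>) j))"
    using int by (intro indep_vars_lebesgue_integral ind) auto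
  also have "\<dots> = (\<Prod>j\<in>{k} \<times> {1..x}. pgf p u)"
    by (intro prod.cong) (auto simp: E)
  also have "\<dots> = pgf p u ^ x"
    by simp
  finally show ?thesis .
qed

text \<open>The state at time \<open>k\<close> is a function of the rows below \<open>k\<close>,
  \<open>generation k x\<close> one of row \<open>k\<close>; functions of disjoint blocks of an
  independent family are independent.\<close>

lemma indep_past_generation:
  "indep_var (count_space UNIV) (branching c z \<xi> k) (count_space UNIV) (generation k x)"
proof -
  let ?A = "{..<k} \<times> {1..} :: (nat \<times> nat) set" and ?B = "{k} \<times> {1..} :: (nat \<times> nat) set"
  let ?F = "branching c z (\<lambda>j i y. y (j, i)) k" and ?G = "\<lambda>y. \<Sum>i = 1..x. y (k, i)"
  let ?P = "\<lambda>A. PiM A (\<lambda>_. count_space UNIV) :: (nat \<times> nat \<Rightarrow> nat) measure"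
  have F: "?F \<in> measurable (?P ?A) (count_space UNIV)"
    by (intro measurable_branching measurable_component_singleton) auto
  have G: "?G \<in> measurable (?P ?B) (count_space UNIV)"
    by (intro measurable_sum_nat measurable_component_singleton) auto
  have "indep_var (count_space UNIV) (?F \<circ> (\<lambda>\<omega>. restrict (\<lambda>j. (case j of (k, i) \<Rightarrow> \<xi> k i) \<omega>) ?A))
      (count_space UNIV) (?G \<circ> (\<lambda>\<omega>. restrict (\<lambda>j. (case j of (k, i) \<Rightarrow> \<xi> k i) \<omega>) ?B))"
    by (intro indep_var_compose[OF indep_var_restrict[OF indep_offspring] F G]) auto
  moreover have "?F \<circ> (\<lambda>\<omega>. restrict (\<lambda>j. (case j of (k, i) \<Rightarrow> \<xi> k i) \<omega>) ?A) = branching c z \<xi> k"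
    by (rule ext, unfold o_def, rule branching_depends_on_past) auto
  moreover have "?G \<circ> (\<lambda>\<omega>. restrict (\<lambda>j. (case j of (k, i) \<Rightarrow> \<xi> k i) \<omega>) ?B) = generation k x"
    by (auto simp: fun_eq_iff generation_def)
  ultimately show ?thesis
    by metis
qed

text \<open>The Markov property. On the event that the state is \<open>x\<close>, the next
  generation is \<open>generation k x\<close>, which is independent of that event; summing over
  \<open>x\<close> gives the claim. Nonnegativity of \<open>g\<close> allows the sum and the
  integral to be exchanged in \<open>ennreal\<close>.\<close>

lemma expectation_branching_Suc:
  fixes g :: "nat \<Rightarrow> real"
  assumes nonneg: "\<And>x. 0 \<le> g x" and bound: "\<And>x. g x \<le> B"
  shows "expectation (\<lambda>\<omega>. g (branching c z \<xi> (Suc k) \<omega>))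
       = expectation (\<lambda>\<omega>. expectation (\<lambda>\<omega>'. g (c (generation k (branching c z \<xi> k \<omega>) \<omega>'))))"
proof -
  define Y where "Y = branching c z \<xi> k"
  define \<kappa> where "\<kappa> x = expectation (\<lambda>\<omega>'. g (c (generation k x \<omega>')))" for x
  have [measurable]: "Y \<in> measurable M (count_space UNIV)"
    by (simp add: Y_def)
  have int: "integrable M (\<lambda>\<omega>'. g (c (generation k x \<omega>')))" for x
    using nonneg bound by (intro integrable_bounded_nat[where B = B]) auto
  have \<kappa>: "0 \<le> \<kappa> x" "\<kappa> x \<le> B" for x
    using nonneg bound int unfolding \<kappa>_def by (auto intro!: integral_nonneg integral_le_const)
  have factor: "(\<integral>\<^sup>+\<omega>. indicator {x} (Y \<omega>) * ennreal (g (c (generation k x \<omega>))) \<partial>M)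
      = (\<integral>\<^sup>+\<omega>. indicator {x} (Y \<omega>) * ennreal (\<kappa> x) \<partial>M)" for x
  proof -
    have iv: "indep_var borel (\<lambda>\<omega>. indicator {x} (Y \<omega>) :: real) borel (\<lambda>\<omega>. g (c (generation k x \<omega>)))"
      using indep_var_compose[OF indep_past_generation[of c z k x], of "indicator {x} :: nat \<Rightarrow> real" borel
          "\<lambda>s. g (c s)" borel]
      by (simp add: Y_def o_def)
    have i1: "integrable M (\<lambda>\<omega>. indicator {x} (Y \<omega>) :: real)"
      by (intro integrable_bounded_nat[where B = 1]) (auto simp: indicator_def)
    have "(\<integral>\<^sup>+\<omega>. indicator {x} (Y \<omega>) * ennreal (g (c (generation k x \<omega>))) \<partial>M)
        = (\<integral>\<^sup>+\<omega>. ennreal (indicator {x} (Y \<omega>) * g (c (generation k x \<omega>))) \<partial>M)"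
      by (intro nn_integral_cong) (auto simp: indicator_def)
    also have "\<dots> = ennreal (expectation (\<lambda>\<omega>. indicator {x} (Y \<omega>) * g (c (generation k x \<omega>))))"
      using nonneg by (intro nn_integral_eq_integral indep_var_integrable[OF iv i1 int]) auto
    also have "\<dots> = ennreal (expectation (\<lambda>\<omega>. indicator {x} (Y \<omega>) * \<kappa> x))"
      by (subst indep_var_lebesgue_integral[OF iv i1 int]) (simp add: \<kappa>_def)
    also have "\<dots> = (\<integral>\<^sup>+\<omega>. ennreal (indicator {x} (Y \<omega>) * \<kappa> x) \<partial>M)"
      using \<kappa> i1 by (intro nn_integral_eq_integral[symmetric]) auto
    also have "\<dots> = (\<integral>\<^sup>+\<omega>. indicator {x} (Y \<omega>) * ennreal (\<kappa> x) \<partial>M)"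
      by (intro nn_integral_cong) (auto simp: indicator_def)
    finally show ?thesis .
  qed
  \<comment> \<open>Only the summand with \<open>x = Y \<omega>\<close> survives, so a random index
    is traded for a countable sum.\<close>
  have split: "(\<integral>\<^sup>+\<omega>. ennreal (G (Y \<omega>) \<omega>) \<partial>M)
      = (\<Sum>x. \<integral>\<^sup>+\<omega>. indicator {x} (Y \<omega>) * ennreal (G x \<omega>) \<partial>M)"
    if [measurable]: "\<And>x. G x \<in> borel_measurable M" for G :: "nat \<Rightarrow> 'w \<Rightarrow> real"
  proof -
    have "ennreal (G (Y \<omega>) \<omega>) = (\<Sum>x. indicator {x} (Y \<omega>) * ennreal (G x \<omega>))" for \<omega>
      by (subst suminf_finite[where N = "{Y \<omega>}"]) (auto simp: indicator_def)
    then have "(\<integral>\<^sup>+\<omega>. ennreal (G (Y \<omega>) \<omega>) \<partial>M)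
        = (\<integral>\<^sup>+\<omega>. (\<Sum>x. indicator {x} (Y \<omega>) * ennreal (G x \<omega>)) \<partial>M)"
      by simp
    also have "\<dots> = (\<Sum>x. \<integral>\<^sup>+\<omega>. indicator {x} (Y \<omega>) * ennreal (G x \<omega>) \<partial>M)"
      by (intro nn_integral_suminf borel_measurable_times_ennreal measurable_compose[OF that]
          measurable_compose[OF \<open>Y \<in> _\<close>]) auto
    finally show ?thesis .
  qed
  have "ennreal (expectation (\<lambda>\<omega>. g (branching c z \<xi> (Suc k) \<omega>)))
      = (\<integral>\<^sup>+\<omega>. ennreal (g (c (generation k (Y \<omega>) \<omega>))) \<partial>M)"
    using nonneg bound
    by (subst nn_integral_eq_integral[symmetric])
       (auto intro!: integrable_bounded_nat[where B = B] simp: Y_def generation_def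
         simp del: branching.simps(2), auto)
  also have "\<dots> = (\<integral>\<^sup>+\<omega>. ennreal (\<kappa> (Y \<omega>)) \<partial>M)"
    using split[of "\<lambda>x \<omega>. g (c (generation k x \<omega>))"] split[of "\<lambda>x _. \<kappa> x"] by (simp add: factor)
  also have "\<dots> = ennreal (expectation (\<lambda>\<omega>. \<kappa> (Y \<omega>)))"
    using \<kappa> by (intro nn_integral_eq_integral integrable_bounded_nat[where B = B]) auto
  finally show ?thesis
    using nonneg \<kappa> by (subst (asm) ennreal_inj) (auto simp: \<kappa>_def Y_def intro!: integral_nonneg)
qed

end

subsection \<open>Generating functions\<close>

lemma integrable_power_pmf: "0 \<le> u \<Longrightarrow> u \<le> 1 \<Longrightarrow> integrable (measure_pmf p) (\<lambda>i. u ^ i :: real)"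
  by (intro measure_pmf.integrable_const_bound[where B = 1]) (auto simp: power_le_one)

lemma pgf_mono:
  assumes "0 \<le> u" "u \<le> v" "v \<le> 1"
  shows "pgf p u \<le> pgf p v"
  unfolding pgf_def using assms by (intro integral_mono integrable_power_pmf power_mono) auto

lemma pgf_0: "pgf p 0 = pmf p 0"
proof -
  have "(\<lambda>i. 0 ^ i :: real) = indicator {0 :: nat}"
    by (auto simp: fun_eq_iff power_0_left)
  then show ?thesis
    by (simp add: pgf_def measure_pmf_single)
qed

lemma pgf_1: "pgf p 1 = 1"
  by (simp add: pgf_def)

lemma pgf_nonneg: "0 \<le> u \<Longrightarrow> 0 \<le> pgf p u"
  by (simp add: pgf_def integral_nonneg)

lemma pgf_le_1: "0 \<le> u \<Longrightarrow> u \<le> 1 \<Longrightarrow> pgf p u \<le> 1"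
  using pgf_mono[of u 1 p] by (simp add: pgf_1)

lemma tendsto_pgf:
  assumes "u \<longlonglongrightarrow> v" "\<And>n. 0 \<le> u n" "\<And>n. u n \<le> 1"
  shows "(\<lambda>n. pgf p (u n)) \<longlonglongrightarrow> pgf p v"
  unfolding pgf_def
  by (rule integral_dominated_convergence[where w = "\<lambda>_. 1"])
     (use assms in \<open>auto intro!: tendsto_power simp: power_le_one\<close>)

text \<open>Since \<open>(1 - r\<^sup>i) / (1 - r)\<close> increases to \<open>i\<close> as \<open>r\<close> tends to 1, the slope of the
  generating function at 1 is the mean.\<close>

lemma pgf_less_self:
  assumes mean: "(\<integral>\<^sup>+ i. of_nat i \<partial>measure_pmf p) > (1 :: ennreal)"
  obtains r where "0 < r" "r < 1" "pgf p r < r"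
proof (rule ccontr)
  assume "\<not> thesis"
  \<comment> \<open>Then every chord slope \<open>(1 - pgf p r) / (1 - r)\<close> is at most 1, and
    so is the mean as their limit.\<close>
  with that have ge: "pgf p r \<ge> r" if "0 < r" "r < 1" for r
    using that not_less by blast
  define r :: "nat \<Rightarrow> real" where "r n = 1 - 1 / real (n + 2)" for n
  have r: "0 < r n" "r n < 1" for n
    by (auto simp: r_def field_simps)
  have r_lim: "r \<longlonglongrightarrow> 1"
    unfolding r_def by (rule tendsto_eq_intros LIMSEQ_ignore_initial_segment[OF lim_1_over_n] | simp)+
  \<comment> \<open>Written as a geometric sum, the quotient
    \<open>(1 - r n ^ i) / (1 - r n)\<close> visibly tends to \<open>i\<close>.\<close>
  define S where "S n i = (\<Sum>l<i. r n ^ l)" for n i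
  have S_eq: "S n i = (1 - r n ^ i) / (1 - r n)" for n i
    using r[of n] sum_gp_strict[of "r n" i] by (simp add: S_def)
  have S_le: "(\<integral>\<^sup>+ i. ennreal (S n i) \<partial>measure_pmf p) \<le> 1" for n
  proof -
    have "(\<integral>\<^sup>+ i. ennreal (S n i) \<partial>measure_pmf p) = ennreal (measure_pmf.expectation p (S n))"
      using r[of n]
      by (intro nn_integral_eq_integral)
         (auto simp: S_eq[abs_def] S_eq power_le_one
           intro!: integrable_divide Bochner_Integration.integrable_diff integrable_power_pmf)
    also have "measure_pmf.expectation p (S n) = (1 - pgf p (r n)) / (1 - r n)"
      using r[of n] integrable_power_pmf[of "r n" p] by (simp add: S_eq[abs_def] pgf_def)
    also have "\<dots> \<le> 1"
      using r[of n] ge[of "r n"] by (simp add: field_simps)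
    finally show ?thesis
      using ennreal_leI by fastforce
  qed
  have "(\<lambda>n. ennreal (S n i)) \<longlonglongrightarrow> of_nat i" for i
  proof -
    have "(\<lambda>n. S n i) \<longlonglongrightarrow> (\<Sum>l<i. 1 ^ l)"
      unfolding S_def by (intro tendsto_sum tendsto_power r_lim)
    then have "(\<lambda>n. ennreal (S n i)) \<longlonglongrightarrow> ennreal (real i)"
      by (intro tendsto_ennrealI) simp
    then show ?thesis
      by (simp add: ennreal_of_nat_eq_real_of_nat)
  qed
  \<comment> \<open>Fatou's lemma carries the bound 1 from the slopes to the mean.\<close>
  then have "(\<integral>\<^sup>+ i. of_nat i \<partial>measure_pmf p) = (\<integral>\<^sup>+ i. liminf (\<lambda>n. ennreal (S n i)) \<partial>measure_pmf p)"
    by (intro nn_integral_cong lim_imp_Liminf[symmetric]) auto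
  also have "\<dots> \<le> liminf (\<lambda>n. \<integral>\<^sup>+ i. ennreal (S n i) \<partial>measure_pmf p)"
    by (rule nn_integral_liminf) auto
  also have "\<dots> \<le> limsup (\<lambda>n. \<integral>\<^sup>+ i. ennreal (S n i) \<partial>measure_pmf p)"
    by (intro Liminf_le_Limsup sequentially_bot)
  also have "\<dots> \<le> 1"
    by (intro Limsup_bounded always_eventually allI S_le)
  finally show False
    using mean by simp
qed

subsection \<open>Limits from geometric bounds on a tail\<close>

text \<open>Here \<open>a n k\<close> stands for the tail \<open>P(U > k)\<close> and
  \<open>y n\<close> for \<open>q ^ N\<close>. Then
  \<open>a n (nat \<lfloor>t / y n\<rfloor>)\<close> is \<open>P(U * y n > t)\<close>, and the sum
  of the tails is the mean of \<open>U\<close>. The shift \<open>j\<close> costs only about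
  \<open>j * y n\<close>, which tends to 0 for fixed \<open>e\<close>; afterwards \<open>e\<close>
  is taken small.\<close>

lemma geometric_tail_limits:
  fixes a :: "nat \<Rightarrow> nat \<Rightarrow> real" and y :: "nat \<Rightarrow> real"
  assumes y_pos: "\<And>n. 0 < y n" and y_lim: "y \<longlonglongrightarrow> 0"
    and a01: "\<forall>\<^sub>F n in sequentially. \<forall>k. 0 \<le> a n k \<and> a n k \<le> 1"
    and lower: "\<forall>\<^sub>F n in sequentially. \<forall>k. (1 - y n) ^ Suc k \<le> a n k"
    and upper: "\<And>e. 0 < e \<Longrightarrow> e < 1 \<Longrightarrow>
      \<exists>j. \<forall>\<^sub>F n in sequentially. \<forall>k. a n (k + j) \<le> (1 + e) * (1 - (1 - e) * y n) ^ k"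
  shows geometric_tail_limit_at: "0 \<le> t \<Longrightarrow> (\<lambda>n. a n (nat \<lfloor>t / y n\<rfloor>)) \<longlonglongrightarrow> exp (- t)"
    and geometric_tail_limit_sum: "(\<lambda>n. ennreal (y n) * (\<Sum>k. ennreal (a n k))) \<longlonglongrightarrow> 1"
proof -
  have y_half: "\<forall>\<^sub>F n in sequentially. y n < 1 / 2"
    using y_lim by (rule order_tendstoD) simp
  show "(\<lambda>n. a n (nat \<lfloor>t / y n\<rfloor>)) \<longlonglongrightarrow> exp (- t)" if t: "0 \<le> t"
  proof (rule order_tendstoI)
    fix c assume c: "c < exp (- t)"
    \<comment> \<open>By \<open>k * y n \<le> t\<close> and
      \<open>exp (- (y n / (1 - y n))) \<le> 1 - y n\<close>, the lower bound
      \<open>(1 - y n) ^ Suc k\<close> is at least this expression.\<close>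
    have "(\<lambda>n. (1 - y n) * exp (- (t / (1 - y n)))) \<longlonglongrightarrow> (1 - 0) * exp (- (t / (1 - 0)))"
      by (intro tendsto_intros y_lim) auto
    with c have "\<forall>\<^sub>F n in sequentially. c < (1 - y n) * exp (- (t / (1 - y n)))"
      by (intro order_tendstoD) auto
    then show "\<forall>\<^sub>F n in sequentially. c < a n (nat \<lfloor>t / y n\<rfloor>)"
      using lower y_half
    proof eventually_elim
      case (elim n)
      define k where "k = nat \<lfloor>t / y n\<rfloor>"
      have k: "real k * y n \<le> t"
        using t y_pos[of n] by (simp add: k_def field_simps of_nat_nat)
           (metis floor_divide_lower mult.commute)
      have "exp (- (y n / (1 - y n))) \<le> 1 - y n"
      proof -
        have "1 + y n / (1 - y n) \<le> exp (y n / (1 - y n))"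
          by (rule exp_ge_add_one_self)
        moreover have "1 + y n / (1 - y n) = 1 / (1 - y n)"
          using elim by (simp add: field_simps)
        ultimately have "1 / (1 - y n) \<le> exp (y n / (1 - y n))"
          by simp
        then show ?thesis
          using elim by (simp add: exp_minus field_simps)
      qed
      then have "exp (- (y n / (1 - y n))) ^ k \<le> (1 - y n) ^ k"
        by (intro power_mono) auto
      moreover have "exp (- (t / (1 - y n))) \<le> exp (- (y n / (1 - y n))) ^ k"
        using k elim by (simp add: exp_of_nat_mult[symmetric] divide_right_mono)
      ultimately have "(1 - y n) * exp (- (t / (1 - y n))) \<le> (1 - y n) * (1 - y n) ^ k"
        using elim by (intro mult_left_mono) auto
      also have "\<dots> \<le> a n k"
        using elim by simp
      finally show ?case
        using elim by (simp add: k_def)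
    qed
  next
    fix c assume c: "exp (- t) < c"
    \<comment> \<open>As \<open>e\<close> tends to 0 the limit is \<open>exp (- t) < c\<close>, so
      some admissible \<open>e\<close> keeps the bound below \<open>c\<close>.\<close>
    have "((\<lambda>e. (1 + e) * exp (- ((1 - e) * t))) \<longlongrightarrow> (1 + 0) * exp (- ((1 - 0) * t))) (at_right 0)"
      by (intro tendsto_intros)
    with c have "\<forall>\<^sub>F e in at_right 0. (1 + e) * exp (- ((1 - e) * t)) < c"
      by (intro order_tendstoD) auto
    moreover have "\<forall>\<^sub>F e in at_right (0 :: real). 0 < e \<and> e < 1"
      by (auto simp: eventually_at_right_field intro!: exI[of _ 1])
    ultimately have "\<forall>\<^sub>F e in at_right 0. (1 + e) * exp (- ((1 - e) * t)) < c \<and> 0 < e \<and> e < 1"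
      by eventually_elim auto
    then obtain e where e: "(1 + e) * exp (- ((1 - e) * t)) < c" "0 < e" "e < 1"
      using eventually_happens trivial_limit_at_right_real by blast
    obtain j where j: "\<forall>\<^sub>F n in sequentially. \<forall>k. a n (k + j) \<le> (1 + e) * (1 - (1 - e) * y n) ^ k"
      using upper[OF e(2,3)] by auto
    \<comment> \<open>Of the \<open>j + 1\<close> lost steps, \<open>j\<close> come from the shift
      in the upper bound and one from rounding down.\<close>
    have "(\<lambda>n. (1 + e) * exp (- ((1 - e) * (t - y n * real (j + 1))))) \<longlonglongrightarrow>
        (1 + e) * exp (- ((1 - e) * (t - 0 * real (j + 1))))"
      by (intro tendsto_intros y_lim)
    with e have "\<forall>\<^sub>F n in sequentially. (1 + e) * exp (- ((1 - e) * (t - y n * real (j + 1)))) < c"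
      by (intro order_tendstoD) auto
    then show "\<forall>\<^sub>F n in sequentially. a n (nat \<lfloor>t / y n\<rfloor>) < c"
      using j a01 y_half
    proof eventually_elim
      case (elim n)
      define k where "k = nat \<lfloor>t / y n\<rfloor>"
      have "t / y n < real k + 1"
        using t y_pos[of n] by (simp add: k_def)
      then have k: "t < y n * (real k + 1)"
        using y_pos[of n] by (simp add: field_simps)
      have "a n k \<le> (1 + e) * exp (- ((1 - e) * (t - y n * real (j + 1))))"
      proof (cases "j \<le> k")
        case True
        have y1: "(1 - e) * y n \<le> 1"
          using e y_pos[of n] elim by (intro mult_le_one) auto
        have "a n k \<le> (1 + e) * (1 - (1 - e) * y n) ^ (k - j)"
          using elim True by (metis le_add_diff_inverse2)
        also have "\<dots> \<le> (1 + e) * exp (- ((1 - e) * y n)) ^ (k - j)"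
          using e y1 exp_ge_add_one_self[of "- ((1 - e) * y n)"]
          by (intro mult_left_mono power_mono) auto
        also have "exp (- ((1 - e) * y n)) ^ (k - j) = exp (- ((1 - e) * (y n * real (k - j))))"
          by (simp add: exp_of_nat_mult[symmetric] ac_simps)
        also have "\<dots> \<le> exp (- ((1 - e) * (t - y n * real (j + 1))))"
        proof -
          have "t - y n * real (j + 1) \<le> y n * real (k - j)"
            using k True by (simp add: of_nat_diff algebra_simps)
          then have "(1 - e) * (t - y n * real (j + 1)) \<le> (1 - e) * (y n * real (k - j))"
            using e by (intro mult_left_mono) auto
          then show ?thesis
            by simp
        qed
        finally show ?thesis
          using e by simp
      next
        \<comment> \<open>With fewer than \<open>j\<close> steps the geometric bound says nothing,
          but the exponent is nonnegative and the right side at least 1.\<close>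
        case False
        then have "y n * (real k + 1) \<le> y n * real (j + 1)"
          using y_pos[of n] by (intro mult_left_mono) auto
        with k have "t - y n * real (j + 1) \<le> 0"
          by simp
        then have "(1 - e) * (t - y n * real (j + 1)) \<le> 0"
          using e by (intro mult_nonneg_nonpos) auto
        then have "1 \<le> exp (- ((1 - e) * (t - y n * real (j + 1))))"
          by simp
        then have "1 * 1 \<le> (1 + e) * exp (- ((1 - e) * (t - y n * real (j + 1))))"
          using e by (intro mult_mono) auto
        moreover have "a n k \<le> 1"
          using elim by auto
        ultimately show ?thesis
          by linarith
      qed
      then show ?case
        using elim by (simp add: k_def)
    qed
  qed
  \<comment> \<open>The first \<open>j\<close> terms are at most 1 each; the others lie below a
    geometric series with sum \<open>(1 + e) / ((1 - e) * y n)\<close>.\<close>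
  have sum_bound: "\<exists>j. \<forall>\<^sub>F n in sequentially.
      summable (a n) \<and> y n * suminf (a n) \<le> y n * real j + (1 + e) / (1 - e)"
    if e: "0 < e" "e < 1" for e
  proof -
    obtain j where j: "\<forall>\<^sub>F n in sequentially. \<forall>k. a n (k + j) \<le> (1 + e) * (1 - (1 - e) * y n) ^ k"
      using upper[OF e] by auto
    from j a01 y_half have "\<forall>\<^sub>F n in sequentially.
      summable (a n) \<and> y n * suminf (a n) \<le> y n * real j + (1 + e) / (1 - e)"
    proof eventually_elim
      case (elim n)
      define z where "z = (1 - e) * y n"
      have z: "0 < z" "z < 1"
      proof -
        have "(1 - e) * y n \<le> 1 * y n"
          using e y_pos[of n] by (intro mult_right_mono) auto
        then show "z < 1"
          using elim by (simp add: z_def)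
      qed (use e y_pos in \<open>simp add: z_def\<close>)
      have geo: "(\<lambda>k. (1 + e) * (1 - z) ^ k) sums ((1 + e) * (1 / (1 - (1 - z))))"
        using z by (intro sums_mult geometric_sums) auto
      have sa: "summable (\<lambda>k. a n (k + j))"
        by (rule summable_comparison_test'[OF sums_summable[OF geo], of 0]) (use elim in \<open>auto simp: z_def\<close>)
      then have "summable (a n)"
        by (simp add: summable_iff_shift)
      have "suminf (a n) = (\<Sum>k. a n (k + j)) + (\<Sum>k<j. a n k)"
        using \<open>summable (a n)\<close> by (rule suminf_split_initial_segment)
      also have "\<dots> \<le> (1 + e) / z + (\<Sum>k<j. 1)"
        using elim suminf_le[OF _ sa sums_summable[OF geo]] sums_unique[OF geo]
        by (intro add_mono sum_mono) (auto simp: z_def)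
      finally have "y n * suminf (a n) \<le> y n * ((1 + e) / z + real j)"
        using y_pos[of n] by (intro mult_left_mono) auto
      also have "\<dots> = y n * real j + (1 + e) / (1 - e)"
        using e y_pos[of n] by (simp add: z_def field_simps)
      finally show ?case
        using \<open>summable (a n)\<close> by simp
    qed
    then show ?thesis ..
  qed
  have ev_summable: "\<forall>\<^sub>F n in sequentially. summable (a n)"
    using sum_bound[of "1 / 2"] by (auto elim: eventually_mono)
  have "(\<lambda>n. y n * suminf (a n)) \<longlonglongrightarrow> 1"
  proof (rule order_tendstoI)
    fix c :: real assume "c < 1"
    \<comment> \<open>The lower geometric series has sum \<open>(1 - y n) / y n\<close>.\<close>
    have "(\<lambda>n. 1 - y n) \<longlonglongrightarrow> 1 - 0"
      by (intro tendsto_intros y_lim)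
    with \<open>c < 1\<close> have "\<forall>\<^sub>F n in sequentially. c < 1 - y n"
      by (intro order_tendstoD) auto
    then show "\<forall>\<^sub>F n in sequentially. c < y n * suminf (a n)"
      using ev_summable lower y_half
    proof eventually_elim
      case (elim n)
      have geo: "(\<lambda>k. (1 - y n) * (1 - y n) ^ k) sums ((1 - y n) * (1 / (1 - (1 - y n))))"
        using elim y_pos[of n] by (intro sums_mult geometric_sums) auto
      have "(1 - y n) * (1 / (1 - (1 - y n))) \<le> suminf (a n)"
        using sums_unique[OF geo] elim suminf_le[OF _ sums_summable[OF geo], of "a n"] by auto
      then have "1 - y n \<le> y n * suminf (a n)"
        using y_pos[of n] by (simp add: field_simps)
      with elim show ?case by simp
    qed
  next
    fix c :: real assume c: "1 < c"
    have "((\<lambda>e. (1 + e) / (1 - e)) \<longlongrightarrow> (1 + 0) / (1 - 0 :: real)) (at_right 0)"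
      by (intro tendsto_intros) auto
    with c have "\<forall>\<^sub>F e in at_right 0. (1 + e) / (1 - e) < c"
      by (intro order_tendstoD) auto
    moreover have "\<forall>\<^sub>F e in at_right (0 :: real). 0 < e \<and> e < 1"
      by (auto simp: eventually_at_right_field intro!: exI[of _ 1])
    ultimately have "\<forall>\<^sub>F e in at_right 0. (1 + e) / (1 - e) < c \<and> 0 < e \<and> e < 1"
      by eventually_elim auto
    then obtain e where e: "(1 + e) / (1 - e) < c" "0 < e" "e < 1"
      using eventually_happens trivial_limit_at_right_real by blast
    obtain j where j: "\<forall>\<^sub>F n in sequentially.
        summable (a n) \<and> y n * suminf (a n) \<le> y n * real j + (1 + e) / (1 - e)"
      using sum_bound[OF e(2,3)] by auto
    have "(\<lambda>n. y n * real j + (1 + e) / (1 - e)) \<longlonglongrightarrow> 0 * real j + (1 + e) / (1 - e)"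
      by (intro tendsto_intros y_lim)
    with e have "\<forall>\<^sub>F n in sequentially. y n * real j + (1 + e) / (1 - e) < c"
      by (intro order_tendstoD) auto
    with j show "\<forall>\<^sub>F n in sequentially. y n * suminf (a n) < c"
      by eventually_elim auto
  qed
  then have "(\<lambda>n. ennreal (y n * suminf (a n))) \<longlonglongrightarrow> ennreal 1"
    by (rule tendsto_ennrealI)
  moreover have "\<forall>\<^sub>F n in sequentially. ennreal (y n * suminf (a n)) = ennreal (y n) * (\<Sum>k. ennreal (a n k))"
    using ev_summable a01
  proof eventually_elim
    case (elim n)
    then show ?case
      using y_pos[of n] by (subst suminf_ennreal2) (auto simp: ennreal_mult suminf_nonneg less_imp_le)
  qed
  ultimately show "(\<lambda>n. ennreal (y n) * (\<Sum>k. ennreal (a n k))) \<longlonglongrightarrow> 1"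
    using Lim_transform_eventually by fastforce
qed

subsection \<open>Extinction probability\<close>

context offspring_family
begin

text \<open>Conditioning on generation \<open>k\<close> replaces \<open>u\<close> by
  \<open>pgf p u\<close>, hence the induction over all \<open>u\<close>.\<close>

lemma expectation_power_galton_watson:
  assumes "0 \<le> u" "u \<le> 1"
  shows "expectation (\<lambda>\<omega>. u ^ galton_watson \<xi> k \<omega>) = (pgf p ^^ k) u"
  using assms
proof (induction k arbitrary: u)
  case (Suc k)
  have "expectation (\<lambda>\<omega>. u ^ galton_watson \<xi> (Suc k) \<omega>) = expectation (\<lambda>\<omega>. pgf p u ^ galton_watson \<xi> k \<omega>)"
    using expectation_branching_Suc[of "\<lambda>x. u ^ x" 1 "\<lambda>s. s" 1 k] Suc.prems
    by (simp add: galton_watson_eq_branching power_le_one expectation_power_generation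
        del: branching.simps(2))
  also have "\<dots> = (pgf p ^^ k) (pgf p u)"
    using Suc by (simp add: pgf_nonneg pgf_le_1)
  finally show ?case
    by (simp add: funpow_swap1)
qed (simp add: prob_space)

text \<open>The events of extinction by time \<open>k\<close> increase, since 0 is absorbing, and
  their probabilities are the values at 0 of the generating function of generation
  \<open>k\<close>.\<close>

lemma tendsto_extinction_probability:
  "(\<lambda>k. (pgf p ^^ k) 0) \<longlonglongrightarrow> extinction_probability M \<xi>"
proof -
  let ?A = "\<lambda>k. {\<omega> \<in> space M. galton_watson \<xi> k \<omega> = 0}"
  have [measurable]: "galton_watson \<xi> k \<in> measurable M (count_space UNIV)" for k
    using measurable_branching_offspring[of "\<lambda>s. s" 1 k]
    by (simp add: galton_watson_eq_branching[abs_def] cong: measurable_cong)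
  have "(\<lambda>k. prob (?A k)) \<longlonglongrightarrow> prob (\<Union>k. ?A k)"
    by (intro finite_Lim_measure_incseq incseq_SucI) auto
  moreover have "prob (?A k) = (pgf p ^^ k) 0" for k
  proof -
    have "prob (?A k) = expectation (indicator (?A k))"
      by simp
    \<comment> \<open>\<open>0 ^ n\<close> is 1 for \<open>n = 0\<close> and 0 otherwise.\<close>
    also have "\<dots> = expectation (\<lambda>\<omega>. 0 ^ galton_watson \<xi> k \<omega>)"
      by (intro Bochner_Integration.integral_cong) (auto simp: indicator_def power_0_left)
    finally show ?thesis
      by (simp add: expectation_power_galton_watson)
  qed
  moreover have "(\<Union>k. ?A k) = {\<omega> \<in> space M. \<exists>k. galton_watson \<xi> k \<omega> = 0}"
    by auto
  ultimately show ?thesis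
    by (simp add: extinction_probability_def)
qed

end

lemma funpow_pgf_bounds: "0 \<le> (pgf p ^^ k) 0" "(pgf p ^^ k) 0 \<le> 1"
  by (induction k) (auto simp: pgf_nonneg pgf_le_1)

text \<open>The iterates from 0 increase and stay below every \<open>r\<close> with
  \<open>pgf p r \<le> r\<close>; continuity makes their limit a fixed point. This locates
  \<open>q\<close> without solving the equation.\<close>

lemma pgf_iteration_limit:
  assumes lim: "(\<lambda>k. (pgf p ^^ k) 0) \<longlonglongrightarrow> q"
  shows pgf_limit_fixed: "pgf p q = q"
    and pgf_limit_least: "0 \<le> r \<Longrightarrow> r \<le> 1 \<Longrightarrow> pgf p r \<le> r \<Longrightarrow> q \<le> r"
    and funpow_pgf_le_limit: "(pgf p ^^ k) 0 \<le> q"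
proof -
  have "(\<lambda>k. pgf p ((pgf p ^^ k) 0)) \<longlonglongrightarrow> pgf p q"
    by (intro tendsto_pgf lim funpow_pgf_bounds)
  moreover have "(\<lambda>k. pgf p ((pgf p ^^ k) 0)) \<longlonglongrightarrow> q"
    using LIMSEQ_Suc[OF lim] by simp
  ultimately show "pgf p q = q"
    using LIMSEQ_unique by blast
next
  assume r: "0 \<le> r" "r \<le> 1" "pgf p r \<le> r"
  have "(pgf p ^^ k) 0 \<le> r" for k
  proof (induction k)
    case (Suc k)
    then have "pgf p ((pgf p ^^ k) 0) \<le> pgf p r"
      using r funpow_pgf_bounds by (intro pgf_mono) auto
    with r show ?case by simp
  qed (use r in simp)
  then show "q \<le> r"
    using LIMSEQ_le_const2[OF lim] by blast
next
  have "(pgf p ^^ k) 0 \<le> (pgf p ^^ Suc k) 0" for k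
  proof (induction k)
    case (Suc k)
    then have "pgf p ((pgf p ^^ k) 0) \<le> pgf p ((pgf p ^^ Suc k) 0)"
      using funpow_pgf_bounds[where k = "Suc k" and p = p] funpow_pgf_bounds[where k = k and p = p] by (intro pgf_mono) auto
    then show ?case by simp
  qed (simp add: pgf_nonneg)
  then have "incseq (\<lambda>k. (pgf p ^^ k) 0)"
    by (rule incseq_SucI)
  then show "(pgf p ^^ k) 0 \<le> q"
    using lim by (rule incseq_le)
qed

subsection \<open>Survival of the censored process\<close>

text \<open>Factoring out \<open>1 - u\<close> and \<open>1 - q\<close> leaves geometric sums, and
  the one with the larger base is larger. A comparison at \<open>x = 1\<close> thus extends to all
  \<open>x\<close>; it is later applied with \<open>u\<close> an iterate close to
  \<open>q\<close>.\<close>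

lemma one_minus_power_le:
  fixes u q :: real
  assumes "0 \<le> u" "u \<le> q" "q \<le> 1" "1 - u \<le> c * (1 - q)"
  shows "1 - u ^ x \<le> c * (1 - q ^ x)"
proof -
  have "1 - u ^ x = (1 - u) * (\<Sum>i<x. u ^ i)"
    by (simp add: one_diff_power_eq)
  also have "\<dots> \<le> c * (1 - q) * (\<Sum>i<x. q ^ i)"
    using assms by (intro mult_mono sum_mono power_mono sum_nonneg) auto
  also have "\<dots> = c * (1 - q ^ x)"
    by (simp add: one_diff_power_eq mult.assoc)
  finally show ?thesis .
qed

context offspring_family
begin

lemma measurable_censored_gw[measurable]: "censored_gw N \<xi> k \<in> measurable M (count_space UNIV)"
  using measurable_branching_offspring[of "min N" N k]
  by (simp add: censored_gw_eq_branching[abs_def] cong: measurable_cong)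

lemma expectation_censored_gw_Suc:
  fixes g :: "nat \<Rightarrow> real"
  assumes "\<And>x. 0 \<le> g x" and "\<And>x. g x \<le> B"
  shows "expectation (\<lambda>\<omega>. g (censored_gw N \<xi> (Suc k) \<omega>))
       = expectation (\<lambda>\<omega>. expectation (\<lambda>\<omega>'. g (min N (generation k (censored_gw N \<xi> k \<omega>) \<omega>'))))"
  unfolding censored_gw_eq_branching by (rule expectation_branching_Suc[OF assms])

lemma integrable_power_nat:
  assumes "Y \<in> measurable M (count_space UNIV)" "0 \<le> u" "u \<le> 1"
  shows "integrable M (\<lambda>\<omega>. u ^ Y \<omega> :: real)"
  using assms by (intro integrable_bounded_nat[where B = 1]) (auto simp: power_le_one)

lemma prob_censored_gw_pos:
  "prob {\<omega> \<in> space M. censored_gw N \<xi> k \<omega> \<noteq> 0} = expectation (\<lambda>\<omega>. 1 - 0 ^ censored_gw N \<xi> k \<omega>)"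
proof -
  have "prob {\<omega> \<in> space M. censored_gw N \<xi> k \<omega> \<noteq> 0}
      = expectation (indicator {\<omega> \<in> space M. censored_gw N \<xi> k \<omega> \<noteq> 0})"
    by simp
  also have "\<dots> = expectation (\<lambda>\<omega>. 1 - 0 ^ censored_gw N \<xi> k \<omega>)"
    by (intro Bochner_Integration.integral_cong) (auto simp: indicator_def power_0_left)
  finally show ?thesis .
qed

text \<open>\<open>1 - q ^ x\<close> lies below the indicator of \<open>x \<noteq> 0\<close>, and
  its mean shrinks at most by the factor \<open>1 - q ^ N\<close> in each step. The start at
  \<open>N\<close> contributes one more such factor, whence \<open>Suc k\<close>.\<close>

lemma censored_survival_lower:
  assumes q: "0 < q" "q < 1" "pgf p q = q"
  shows "(1 - q ^ N) ^ Suc k \<le> prob {\<omega> \<in> space M. censored_gw N \<xi> k \<omega> \<noteq> 0}"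
proof -
  have qN: "0 \<le> q ^ n" "q ^ n \<le> 1" for n
    using q by (auto simp: power_le_one)
  have "(1 - q ^ N) ^ Suc k \<le> expectation (\<lambda>\<omega>. 1 - q ^ censored_gw N \<xi> k \<omega>)"
  proof (induction k)
    case (Suc k)
    \<comment> \<open>For \<open>s \<le> N\<close> the first factor is dropped, for
      \<open>s > N\<close> the second.\<close>
    have pointwise: "(1 - q ^ N) * (1 - q ^ s) \<le> 1 - q ^ min N s" for s
      using mult_left_le[of "1 - q ^ s" "1 - q ^ N"] mult_left_le_one_le[of "1 - q ^ s" "1 - q ^ N"] qN[of N] qN[of s]
      by (cases "s \<le> N") (auto simp: min_def)
    have "(1 - q ^ N) ^ Suc (Suc k) \<le> (1 - q ^ N) * expectation (\<lambda>\<omega>. 1 - q ^ censored_gw N \<xi> k \<omega>)"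
      using Suc qN[of N] by (auto intro!: mult_left_mono)
    also have "\<dots> = expectation (\<lambda>\<omega>. (1 - q ^ N) * (1 - q ^ censored_gw N \<xi> k \<omega>))"
      by simp
    also have "\<dots> \<le> expectation (\<lambda>\<omega>. expectation
        (\<lambda>\<omega>'. 1 - q ^ min N (generation k (censored_gw N \<xi> k \<omega>) \<omega>')))"
    proof -
      have kernel: "(1 - q ^ N) * (1 - q ^ x) \<le> expectation (\<lambda>\<omega>'. 1 - q ^ min N (generation k x \<omega>'))" for x
      proof -
        \<comment> \<open>Harmonicity: \<open>pgf p q = q\<close> makes \<open>q ^ x\<close> the
          mean of \<open>q ^ generation k x\<close>.\<close>
        have "(1 - q ^ N) * (1 - q ^ x) = expectation (\<lambda>\<omega>'. (1 - q ^ N) * (1 - q ^ generation k x \<omega>'))"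
          using q by (simp add: expectation_power_generation integrable_power_nat prob_space)
        also have "\<dots> \<le> expectation (\<lambda>\<omega>'. 1 - q ^ min N (generation k x \<omega>'))"
          using q pointwise
          by (intro integral_mono integrable_mult_right Bochner_Integration.integrable_diff integrable_power_nat)
             auto
        finally show ?thesis .
      qed
      have bound: "\<bar>expectation (\<lambda>\<omega>'. 1 - q ^ min N (generation k x \<omega>'))\<bar> \<le> 1" for x
      proof -
        have "0 \<le> expectation (\<lambda>\<omega>'. 1 - q ^ min N (generation k x \<omega>'))"
          using qN by (intro Bochner_Integration.integral_nonneg) auto
        moreover have "expectation (\<lambda>\<omega>'. 1 - q ^ min N (generation k x \<omega>')) \<le> 1"
          using qN q by (intro integral_le_const Bochner_Integration.integrable_diff integrable_power_nat) auto
        ultimately show ?thesis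
          by simp
      qed
      show ?thesis
        using q kernel bound
        by (intro integral_mono integrable_mult_right Bochner_Integration.integrable_diff integrable_power_nat
            integrable_bounded_nat[where B = 1 and Y = "censored_gw N \<xi> k"]) auto
    qed
    also have "\<dots> = expectation (\<lambda>\<omega>. 1 - q ^ censored_gw N \<xi> (Suc k) \<omega>)"
      using qN by (subst expectation_censored_gw_Suc[where B = 1]) auto
    finally show ?case .
  qed (simp add: prob_space)
  also have "\<dots> \<le> expectation (\<lambda>\<omega>. 1 - 0 ^ censored_gw N \<xi> k \<omega>)"
    using q by (intro integral_mono Bochner_Integration.integrable_diff integrable_power_nat)
      (auto simp: power_mono)
  finally show ?thesis
    unfolding prob_censored_gw_pos .
qed

text \<open>Integrates a pointwise estimate of the transition kernel over the current state; the
  bound on \<open>h\<close> serves integrability.\<close>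

lemma expectation_censored_gw_Suc_le:
  fixes g h :: "nat \<Rightarrow> real"
  assumes g: "\<And>x. 0 \<le> g x" "\<And>x. g x \<le> B" and h: "\<And>x. \<bar>h x\<bar> \<le> C"
    and kernel: "\<And>x. expectation (\<lambda>\<omega>'. g (min N (generation k x \<omega>'))) \<le> h x"
  shows "expectation (\<lambda>\<omega>. g (censored_gw N \<xi> (Suc k) \<omega>)) \<le> expectation (\<lambda>\<omega>. h (censored_gw N \<xi> k \<omega>))"
proof -
  define \<kappa> where "\<kappa> x = expectation (\<lambda>\<omega>'. g (min N (generation k x \<omega>')))" for x
  have nonneg: "0 \<le> \<kappa> x" for x
    using g by (simp add: \<kappa>_def integral_nonneg)
  have "\<bar>\<kappa> x\<bar> \<le> C" for x
    using h[of x] kernel[of x] nonneg[of x] unfolding \<kappa>_def by linarith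
  then have "expectation (\<lambda>\<omega>. \<kappa> (censored_gw N \<xi> k \<omega>)) \<le> expectation (\<lambda>\<omega>. h (censored_gw N \<xi> k \<omega>))"
    using h kernel
    by (intro integral_mono integrable_bounded_nat[where B = C and Y = "censored_gw N \<xi> k"]) (auto simp: \<kappa>_def)
  then show ?thesis
    by (subst expectation_censored_gw_Suc[OF g]) (auto simp: \<kappa>_def)
qed

text \<open>Removing the cap can only increase \<open>1 - u ^ x\<close>, and a free step replaces
  \<open>u\<close> by \<open>pgf p u\<close>. The iteration starts at \<open>u = 0\<close>, where
  \<open>1 - 0 ^ x\<close> is the indicator of survival.\<close>

lemma censored_survival_le_funpow:
  "prob {\<omega> \<in> space M. censored_gw N \<xi> (k + j) \<omega> \<noteq> 0}
     \<le> expectation (\<lambda>\<omega>. 1 - (pgf p ^^ j) 0 ^ censored_gw N \<xi> k \<omega>)"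
proof -
  have "expectation (\<lambda>\<omega>. 1 - u ^ censored_gw N \<xi> (k + j) \<omega>)
      \<le> expectation (\<lambda>\<omega>. 1 - (pgf p ^^ j) u ^ censored_gw N \<xi> k \<omega>)" if "0 \<le> u" "u \<le> 1" for u
    using that
  proof (induction j arbitrary: u)
    case (Suc j)
    have "expectation (\<lambda>\<omega>'. 1 - u ^ min N (generation (k + j) x \<omega>')) \<le> 1 - pgf p u ^ x" for x
    proof -
      have "expectation (\<lambda>\<omega>'. 1 - u ^ min N (generation (k + j) x \<omega>'))
          \<le> expectation (\<lambda>\<omega>'. 1 - u ^ generation (k + j) x \<omega>')"
        using Suc.prems
        by (intro integral_mono Bochner_Integration.integrable_diff integrable_power_nat)
           (auto intro!: power_decreasing)
      also have "\<dots> = 1 - pgf p u ^ x"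
        using Suc.prems by (simp add: expectation_power_generation integrable_power_nat prob_space)
      finally show ?thesis .
    qed
    then have "expectation (\<lambda>\<omega>. 1 - u ^ censored_gw N \<xi> (Suc (k + j)) \<omega>)
        \<le> expectation (\<lambda>\<omega>. 1 - pgf p u ^ censored_gw N \<xi> (k + j) \<omega>)"
      using Suc.prems
      by (intro expectation_censored_gw_Suc_le[where B = 1 and C = 1])
         (auto simp: power_le_one pgf_nonneg pgf_le_1)
    also have "\<dots> \<le> expectation (\<lambda>\<omega>. 1 - (pgf p ^^ j) (pgf p u) ^ censored_gw N \<xi> k \<omega>)"
      using Suc by (simp add: pgf_nonneg pgf_le_1)
    finally show ?case
      by (simp add: funpow_swap1 del: censored_gw.simps(2))
  qed simp
  from this[of 0] show ?thesis
    unfolding prob_censored_gw_pos by simp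
qed

text \<open>The perturbation \<open>K * r ^ x\<close> of \<open>1 - q ^ x\<close> pays for the states below \<open>N - m\<close>, where
  censoring is too rare for \<open>1 - q ^ x\<close> to lose a proportion of about \<open>q ^ N\<close> in one step. For the
  other states this loss comes from \<open>q ^ min N s + q ^ max N s = q ^ N + q ^ s\<close>. The jump of the
  perturbation at 0 is harmless since 0 is absorbing.\<close>

lemma censored_supermartingale:
  assumes q: "0 < q" "q < 1" "pgf p q = q" and r: "q \<le> r" "r < 1" "pgf p r < r"
    and e: "0 < e" "e < 1 / 2" and mN: "m \<le> N"
    and m: "2 * r ^ m \<le> e * (1 - pgf p r / r)"
    and N: "pgf p r ^ (N - m) \<le> e * r ^ N"
    and K: "K = 2 / ((1 - pgf p r / r) * r ^ (N - m))" "q ^ N * K \<le> e"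
  shows "expectation (\<lambda>\<omega>. 1 - q ^ censored_gw N \<xi> k \<omega>) \<le> (1 + e) * (1 - (1 - 2 * e) / (1 + e) * q ^ N) ^ k"
proof -
  define f where "f = pgf p r"
  define \<rho> where "\<rho> = f / r"
  \<comment> \<open>A step from a positive state will lose at least
    \<open>(1 - 2 * e) * q ^ N\<close>; since \<open>H x \<le> 1 + e\<close>, this is at least the
    proportion \<open>l\<close> of \<open>H x\<close>.\<close>
  define l where "l = (1 - 2 * e) / (1 + e) * q ^ N"
  define H where "H x = (if x = 0 then 0 else 1 - q ^ x + q ^ N * K * r ^ x)" for x
  have r0: "0 < r"
    using q r by simp
  have f: "0 \<le> f" "f < r"
    using r r0 by (auto simp: f_def pgf_nonneg)
  then have \<rho>: "0 \<le> \<rho>" "\<rho> < 1" "f = \<rho> * r"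
    using r0 by (auto simp: \<rho>_def)
  have K0: "0 < K"
    using \<rho> r0 by (simp add: K f_def \<rho>_def)
  \<comment> \<open>Capping at \<open>N\<close> adds at most \<open>q ^ N * K * r ^ N\<close> to the
    perturbation; \<open>m\<close> is chosen to make this at most \<open>e * q ^ N\<close>.\<close>
  have K_le: "K * r ^ N \<le> e"
  proof -
    have "r ^ N = r ^ (N - m) * r ^ m"
      using mN by (simp flip: power_add)
    then have "K * r ^ N = 2 * r ^ m / (1 - \<rho>)"
      using r0 by (simp add: K \<rho>_def f_def)
    also have "\<dots> \<le> e"
      using m \<rho> by (simp add: \<rho>_def f_def pos_divide_le_eq)
    finally show ?thesis .
  qed
  have q01: "0 \<le> q ^ n" "q ^ n \<le> 1" for n
    using q by (auto simp: power_le_one)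
  have r01: "0 \<le> r ^ n" "r ^ n \<le> 1" for n
    using r r0 by (auto simp: power_le_one)
  have H: "0 \<le> H x" "H x \<le> 1 + e" "1 - q ^ x \<le> H x" for x
  proof -
    have "q ^ N * K * r ^ x \<le> q ^ N * K"
      using K0 q01[of N] r01[of x] by (intro mult_left_le) auto
    then show "H x \<le> 1 + e"
      using K q01[of x] e by (auto simp: H_def)
    show "1 - q ^ x \<le> H x"
      using K0 q01[of N] r01[of x] by (auto simp: H_def)
    then show "0 \<le> H x"
      using q01[of x] by linarith
  qed
  have l: "0 \<le> l" "l \<le> 1" "l * (1 + e) = (1 - 2 * e) * q ^ N"
  proof -
    have "(1 - 2 * e) / (1 + e) \<le> 1"
      using e by (simp add: field_simps)
    then show "l \<le> 1"
      unfolding l_def using e q01[of N] by (intro mult_le_one) auto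
  qed (use e q01[of N] in \<open>auto simp: l_def\<close>)
  have kernel: "expectation (\<lambda>\<omega>'. H (min N (generation j x \<omega>'))) \<le> (1 - l) * H x" for j x
  proof (cases "x = 0")
    case True
    then show ?thesis
      by (simp add: generation_def H_def)
  next
    case False
    have int: "integrable M (\<lambda>\<omega>'. v ^ generation j x \<omega>')" if "0 \<le> v" "v \<le> 1" for v :: real
      using that by (intro integrable_power_nat) auto
    have intH: "integrable M (\<lambda>\<omega>'. H (min N (generation j x \<omega>')))"
      using H by (intro integrable_bounded_nat[where B = "1 + e"]) auto
    have H_min: "H (min N s) \<le> 1 - q ^ s - q ^ N + q ^ max N s + q ^ N * K * (r ^ s + r ^ N)" for s
    proof -
      \<comment> \<open>At 0 the value of \<open>H\<close> lies below the formula for positive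
        states, so the formula is an upper bound for every \<open>s\<close>.\<close>
      have "H (min N s) \<le> 1 - q ^ min N s + q ^ N * K * r ^ min N s"
        using K0 q01[of N] r01[of "min N s"] by (auto simp: H_def min_def)
      also have "\<dots> \<le> 1 - q ^ min N s + q ^ N * K * (r ^ s + r ^ N)"
        using K0 q01[of N] r01[of s] r01[of N] by (intro add_left_mono mult_left_mono) (auto simp: min_def)
      finally show ?thesis
        by (auto simp: min_def max_def)
    qed
    have Ef: "expectation (\<lambda>\<omega>'. r ^ generation j x \<omega>') = f ^ x"
      and Eq: "expectation (\<lambda>\<omega>'. q ^ generation j x \<omega>') = q ^ x"
      using r r0 q by (auto simp: f_def expectation_power_generation)
    have f_le_r: "f ^ x \<le> r ^ x"
      using f by (intro power_mono) auto
    have "expectation (\<lambda>\<omega>'. H (min N (generation j x \<omega>'))) \<le> H x - (1 - 2 * e) * q ^ N"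
    proof (cases "x \<le> N - m")
      case True
      \<comment> \<open>Low states: for \<open>q ^ max N s\<close> only the crude bound
        \<open>q ^ N\<close> is taken, so the whole loss must come from the perturbation.\<close>
      have "expectation (\<lambda>\<omega>'. H (min N (generation j x \<omega>')))
          \<le> expectation (\<lambda>\<omega>'. 1 - q ^ generation j x \<omega>' + q ^ N * K * (r ^ generation j x \<omega>' + r ^ N))"
      proof (intro integral_mono intH)
        show "H (min N (generation j x \<omega>')) \<le> 1 - q ^ generation j x \<omega>' + q ^ N * K * (r ^ generation j x \<omega>' + r ^ N)" for \<omega>'
        proof -
          have "q ^ max N (generation j x \<omega>') \<le> q ^ N"
            using q by (intro power_decreasing) auto
          with H_min[of "generation j x \<omega>'"] show ?thesis
            by linarith
        qed
      qed (use int q r r0 in auto)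
      also have "\<dots> = 1 - q ^ x + q ^ N * K * (f ^ x + r ^ N)"
        using int q r r0 by (simp add: Ef Eq prob_space)
      \<comment> \<open>For \<open>x \<ge> 1\<close> a free step shrinks \<open>r ^ x\<close> at
        least by the factor \<open>\<rho>\<close>. Half of the gain
        \<open>(1 - \<rho>) * r ^ x\<close> absorbs \<open>r ^ N\<close>; the other half is at least
        \<open>(1 - \<rho>) / 2 * r ^ (N - m) = 1 / K\<close> and yields the loss
        \<open>q ^ N\<close>. This is the reason for the choice of \<open>K\<close>.\<close>
      also have "\<dots> \<le> H x - q ^ N"
      proof -
        have rx: "r ^ (N - m) \<le> r ^ x"
          using True r r0 by (intro power_decreasing) auto
        have "f ^ x \<le> \<rho> * r ^ x"
        proof -
          have "\<rho> ^ x \<le> \<rho> ^ 1"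
            using False \<rho> by (intro power_decreasing) auto
          then show ?thesis
            using \<rho> r01[of x] by (simp add: power_mult_distrib mult_right_mono)
        qed
        moreover have "r ^ N \<le> (1 - \<rho>) / 2 * r ^ x"
        proof -
          have "e * (1 - \<rho>) \<le> 1 * (1 - \<rho>)"
            using e \<rho> by (intro mult_right_mono) auto
          with m have "2 * r ^ m \<le> 1 - \<rho>"
            by (simp add: \<rho>_def f_def)
          then have "r ^ m * r ^ (N - m) \<le> (1 - \<rho>) / 2 * r ^ x"
            using rx r01 \<rho> by (intro mult_mono) auto
          then show ?thesis
            using mN by (simp flip: power_add)
        qed
        ultimately have "f ^ x + r ^ N \<le> r ^ x - (1 - \<rho>) / 2 * r ^ x"
          by (simp add: field_simps)
        also have "\<dots> \<le> r ^ x - (1 - \<rho>) / 2 * r ^ (N - m)"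
          using rx \<rho> by (intro diff_left_mono mult_left_mono) auto
        also have "\<dots> = r ^ x - 1 / K"
          by (simp add: K \<rho>_def f_def)
        finally have "q ^ N * K * (f ^ x + r ^ N) \<le> q ^ N * K * (r ^ x - 1 / K)"
          using K0 q01[of N] by (intro mult_left_mono) auto
        also have "\<dots> = q ^ N * K * r ^ x - q ^ N"
          using K0 by (simp add: algebra_simps)
        finally show ?thesis
          using False by (simp add: H_def)
      qed
      also have "\<dots> \<le> H x - (1 - 2 * e) * q ^ N"
        using e q01[of N] by (intro diff_left_mono mult_left_le_one_le) auto
      finally show ?thesis .
    next
      case large: False
      \<comment> \<open>High states: one \<open>e\<close> is spent on \<open>q ^ max N s\<close>, of
        mean at most \<open>e * q ^ N\<close>, and the other on \<open>K * r ^ N\<close>.\<close>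
      have "expectation (\<lambda>\<omega>'. H (min N (generation j x \<omega>')))
          \<le> expectation (\<lambda>\<omega>'. 1 - q ^ generation j x \<omega>' - q ^ N + q ^ N / r ^ N * r ^ generation j x \<omega>'
              + q ^ N * K * (r ^ generation j x \<omega>' + r ^ N))"
      proof (intro integral_mono intH)
        fix \<omega>'
        define s where "s = generation j x \<omega>'"
        \<comment> \<open>This bound has the computable mean \<open>q ^ N / r ^ N * f ^ x\<close>,
          which is small because \<open>f ^ (N - m)\<close> is small against
          \<open>r ^ N\<close>.\<close>
        have "q ^ max N s \<le> q ^ N / r ^ N * r ^ s"
        proof (cases "s \<le> N")
          case True
          then have "r ^ N \<le> r ^ s"
            using r r0 by (intro power_decreasing) auto
          then have "q ^ N * r ^ N \<le> q ^ N * r ^ s"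
            using q01[of N] by (intro mult_left_mono)
          then show ?thesis
            using True r0 by (simp add: max_def field_simps)
        next
          case False
          then have s: "s = N + (s - N)"
            by simp
          have "q ^ (s - N) \<le> r ^ (s - N)"
            using q r by (intro power_mono) auto
          then have "q ^ N * q ^ (s - N) \<le> q ^ N * r ^ (s - N)"
            using q01[of N] by (intro mult_left_mono)
          then have "q ^ s \<le> q ^ N * r ^ (s - N)"
            using s by (metis power_add)
          also have "\<dots> = q ^ N / r ^ N * r ^ s"
            using False r0 by (simp add: power_diff)
          finally show ?thesis
            using False by (simp add: max_def)
        qed
        with H_min[of s] show "H (min N (generation j x \<omega>')) \<le> 1 - q ^ generation j x \<omega>' - q ^ N
            + q ^ N / r ^ N * r ^ generation j x \<omega>' + q ^ N * K * (r ^ generation j x \<omega>' + r ^ N)"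
          by (simp add: s_def)
      qed (use int q r r0 in auto)
      also have "\<dots> = 1 - q ^ x - q ^ N + q ^ N * (f ^ x / r ^ N) + q ^ N * (K * f ^ x + K * r ^ N)"
        using int q r r0 by (simp add: Ef Eq prob_space algebra_simps)
      also have "\<dots> \<le> 1 - q ^ x - q ^ N + q ^ N * e + q ^ N * (K * r ^ x + e)"
      proof -
        have "f ^ x \<le> f ^ (N - m)"
          using large f r by (intro power_decreasing) auto
        then have "f ^ x / r ^ N \<le> e"
          using N r0 by (simp add: f_def pos_divide_le_eq)
        moreover have "K * f ^ x + K * r ^ N \<le> K * r ^ x + e"
          using K0 f_le_r K_le by (intro add_mono mult_left_mono) auto
        ultimately show ?thesis
          using q01[of N] by (intro add_mono[OF add_left_mono] mult_left_mono) auto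
      qed
      also have "\<dots> = H x - (1 - 2 * e) * q ^ N"
        using False by (simp add: H_def algebra_simps)
      finally show ?thesis .
    qed
    also have "\<dots> \<le> (1 - l) * H x"
      using mult_left_mono[OF H(2)[of x] l(1)] l(3) by (simp add: algebra_simps)
    finally show ?thesis .
  qed
  have "expectation (\<lambda>\<omega>. H (censored_gw N \<xi> k \<omega>)) \<le> (1 + e) * (1 - l) ^ k"
  proof (induction k)
    case 0
    show ?case
      using H by (simp add: prob_space)
  next
    case (Suc k)
    have "\<bar>(1 - l) * H x\<bar> \<le> 1 + e" for x
      using H[of x] l mult_left_le_one_le[of "H x" "1 - l"] by (simp add: abs_mult)
    then have "expectation (\<lambda>\<omega>. H (censored_gw N \<xi> (Suc k) \<omega>))
        \<le> expectation (\<lambda>\<omega>. (1 - l) * H (censored_gw N \<xi> k \<omega>))"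
      using H kernel by (intro expectation_censored_gw_Suc_le[where B = "1 + e" and C = "1 + e"]) auto
    also have "\<dots> \<le> (1 - l) * ((1 + e) * (1 - l) ^ k)"
      using Suc l by (simp add: mult_left_mono)
    finally show ?case
      by (simp add: mult_ac del: censored_gw.simps(2))
  qed
  moreover have "expectation (\<lambda>\<omega>. 1 - q ^ censored_gw N \<xi> k \<omega>) \<le> expectation (\<lambda>\<omega>. H (censored_gw N \<xi> k \<omega>))"
    using H q
    by (intro integral_mono Bochner_Integration.integrable_diff integrable_power_nat
        integrable_bounded_nat[where B = "1 + e" and g = H]) auto
  ultimately show ?thesis
    by (simp add: l_def)
qed

end

text \<open>The first \<open>k\<close> steps are controlled by the supermartingale, the last
  \<open>j\<close> by iterating the generating function, which replaces the indicator of survival by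
  at most \<open>(1 + d) * (1 - q ^ x)\<close>. The parameters are chosen in the order
  \<open>d\<close>, \<open>j\<close>, \<open>m\<close>, and then \<open>N\<close> large.\<close>

lemma censored_survival_upper:
  assumes fam: "\<And>N. N \<ge> 2 \<Longrightarrow> offspring_family (M N) p (\<xi> N)"
    and lim: "(\<lambda>k. (pgf p ^^ k) 0) \<longlonglongrightarrow> q" and q: "0 < q" "q < 1"
    and r: "q < r" "r < 1" "pgf p r < r"
    and e: "0 < e" "e < 1"
  shows "\<exists>j. \<forall>\<^sub>F N in sequentially. \<forall>k.
    measure (M N) {\<omega> \<in> space (M N). censored_gw N (\<xi> N) (k + j) \<omega> \<noteq> 0}
      \<le> (1 + e) * (1 - (1 - e) * q ^ N) ^ k"
proof -
  \<comment> \<open>A third suffices: \<open>(1 + d) ^ 2 \<le> 1 + 3 * d\<close> and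
    \<open>1 - 3 * d \<le> (1 - 2 * d) / (1 + d)\<close>.\<close>
  define d where "d = e / 3"
  have d: "0 < d" "d < 1 / 2"
    using e by (auto simp: d_def)
  define \<rho> where "\<rho> = pgf p r / r"
  have r0: "0 < r"
    using q r by simp
  have f: "0 \<le> pgf p r"
    using r0 by (simp add: pgf_nonneg)
  have \<rho>: "0 \<le> \<rho>" "\<rho> < 1" "pgf p r = \<rho> * r"
    using r0 r f by (auto simp: \<rho>_def)
  have fixed: "pgf p q = q"
    by (rule pgf_limit_fixed[OF lim])
  have "(\<lambda>k. 1 - (pgf p ^^ k) 0) \<longlonglongrightarrow> 1 - q"
    by (intro tendsto_intros lim)
  moreover have "1 - q < (1 + d) * (1 - q)"
    using d q by simp
  ultimately have "\<forall>\<^sub>F k in sequentially. 1 - (pgf p ^^ k) 0 < (1 + d) * (1 - q)"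
    by (rule order_tendstoD)
  then obtain j where j: "1 - (pgf p ^^ j) 0 < (1 + d) * (1 - q)"
    using eventually_happens trivial_limit_sequentially by blast
  have "(\<lambda>m. 2 * r ^ m) \<longlonglongrightarrow> 2 * 0"
    using r r0 by (intro tendsto_intros LIMSEQ_realpow_zero) auto
  then have "\<forall>\<^sub>F m in sequentially. 2 * r ^ m < d * (1 - \<rho>)"
    using d \<rho> by (intro order_tendstoD(2)[where y = "2 * 0"]) auto
  then obtain m where m: "2 * r ^ m < d * (1 - \<rho>)"
    using eventually_happens trivial_limit_sequentially by blast
  define K where "K N = 2 / ((1 - \<rho>) * r ^ (N - m))" for N
  have "(\<lambda>N. \<rho> ^ N) \<longlonglongrightarrow> 0"
    using \<rho> by (intro LIMSEQ_realpow_zero) auto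
  then have "\<forall>\<^sub>F N in sequentially. \<rho> ^ N < d * r ^ m"
    using d r0 by (intro order_tendstoD(2)[where y = 0]) auto
  \<comment> \<open>Multiplied by \<open>r ^ (N - m)\<close>, this becomes
    \<open>pgf p r ^ (N - m) \<le> d * r ^ N\<close> for \<open>N \<ge> m\<close>.\<close>
  then have ev1: "\<forall>\<^sub>F N in sequentially. \<rho> ^ (N - m) < d * r ^ m"
    using filterlim_minus_const_nat_at_top[of m] by (auto simp: filterlim_iff)
  \<comment> \<open>For \<open>N \<ge> m\<close> this is \<open>q ^ N * K N\<close>; it tends to 0
    because \<open>q < r\<close>.\<close>
  have "(\<lambda>N. (q / r) ^ N * (2 * r ^ m / (1 - \<rho>))) \<longlonglongrightarrow> 0 * (2 * r ^ m / (1 - \<rho>))"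
    using q r r0 by (intro tendsto_mult LIMSEQ_realpow_zero tendsto_const) auto
  then have ev2: "\<forall>\<^sub>F N in sequentially. (q / r) ^ N * (2 * r ^ m / (1 - \<rho>)) < d"
    using d by (intro order_tendstoD(2)[where y = 0]) auto
  have "\<forall>\<^sub>F N in sequentially. \<forall>k.
    measure (M N) {\<omega> \<in> space (M N). censored_gw N (\<xi> N) (k + j) \<omega> \<noteq> 0}
      \<le> (1 + e) * (1 - (1 - e) * q ^ N) ^ k"
    using ev1 ev2 eventually_ge_at_top[of m] eventually_ge_at_top[of 2]
  proof eventually_elim
    case (elim N)
    interpret offspring_family "M N" p "\<xi> N"
      using fam elim by simp
    have r_split: "r ^ N = r ^ (N - m) * r ^ m"
      using elim by (simp flip: power_add)
    have small: "pgf p r ^ (N - m) \<le> d * r ^ N"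
    proof -
      have "\<rho> ^ (N - m) * r ^ (N - m) \<le> d * r ^ m * r ^ (N - m)"
        using elim r0 by (intro mult_right_mono) auto
      then show ?thesis
        by (simp add: \<rho>(3) power_mult_distrib r_split mult_ac)
    qed
    have qK: "q ^ N * K N \<le> d"
    proof -
      have "q ^ N * K N = (q / r) ^ N * (2 * r ^ m / (1 - \<rho>))"
        using r0 by (simp add: K_def power_divide r_split)
      then show ?thesis
        using elim by simp
    qed
    show ?case
    proof
      fix k
      define l where "l = (1 - 2 * d) / (1 + d) * q ^ N"
      have qN: "0 \<le> q ^ N" "q ^ N \<le> 1"
        using q by (auto simp: power_le_one)
      have "prob {\<omega> \<in> space (M N). censored_gw N (\<xi> N) (k + j) \<omega> \<noteq> 0}
          \<le> expectation (\<lambda>\<omega>. 1 - (pgf p ^^ j) 0 ^ censored_gw N (\<xi> N) k \<omega>)"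
        by (rule censored_survival_le_funpow)
      also have "\<dots> \<le> expectation (\<lambda>\<omega>. (1 + d) * (1 - q ^ censored_gw N (\<xi> N) k \<omega>))"
        using q j funpow_pgf_bounds funpow_pgf_le_limit[OF lim]
        by (intro integral_mono integrable_mult_right Bochner_Integration.integrable_diff
            integrable_power_nat one_minus_power_le) auto
      also have "\<dots> \<le> (1 + d) * ((1 + d) * (1 - l) ^ k)"
        unfolding l_def using q r d m small qK elim fixed
        by (subst integral_mult_right_zero, intro mult_left_mono
            censored_supermartingale[where r = r and m = m and K = "K N"])
           (auto simp: K_def \<rho>_def)
      also have "\<dots> = (1 + d) ^ 2 * (1 - l) ^ k"
        by (simp add: power2_eq_square)
      also have "\<dots> \<le> (1 + e) * (1 - (1 - e) * q ^ N) ^ k"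
      proof (intro mult_mono power_mono)
        have "d * d \<le> d * 1"
          using d by (intro mult_left_mono) auto
        moreover have "e = 3 * d"
          by (simp add: d_def)
        ultimately show "(1 + d) ^ 2 \<le> 1 + e"
          by (simp add: power2_eq_square algebra_simps)
        have "(1 - 3 * d) * (1 + d) \<le> 1 - 2 * d"
          using d by (simp add: algebra_simps)
        then have "1 - e \<le> (1 - 2 * d) / (1 + d)"
          using d by (simp add: pos_le_divide_eq d_def)
        then have "(1 - e) * q ^ N \<le> l"
          unfolding l_def using qN(1) by (rule mult_right_mono)
        then show "1 - l \<le> 1 - (1 - e) * q ^ N"
          by simp
        have "(1 - 2 * d) / (1 + d) \<le> 1"
          using d by (simp add: field_simps)
        then have "l \<le> 1"
          unfolding l_def using d qN by (intro mult_le_one) auto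
        then show "0 \<le> 1 - l" "0 \<le> (1 - l) ^ k"
          by auto
      qed (use e in auto)
      finally show "prob {\<omega> \<in> space (M N). censored_gw N (\<xi> N) (k + j) \<omega> \<noteq> 0}
          \<le> (1 + e) * (1 - (1 - e) * q ^ N) ^ k" .
    qed
  qed
  then show ?thesis ..
qed

subsection \<open>Extinction time of the censored process\<close>

lemma censored_gw_absorbed:
  assumes "censored_gw N \<xi> k \<omega> = 0" "k \<le> l"
  shows "censored_gw N \<xi> l \<omega> = 0"
  using assms(2,1) by (induction l rule: dec_induct) auto

text \<open>Since 0 is absorbing, being positive at time \<open>k\<close> excludes every earlier
  zero. The equivalence covers infinite extinction times and turns tails into survival
  probabilities.\<close>

lemma less_censored_extinction_time:
  "enat k < censored_extinction_time N \<xi> \<omega> \<longleftrightarrow> censored_gw N \<xi> k \<omega> \<noteq> 0"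
proof
  have "censored_extinction_time N \<xi> \<omega> \<le> enat k" if "censored_gw N \<xi> k \<omega> = 0"
    unfolding censored_extinction_time_def using that by (intro Inf_lower) auto
  then show "censored_gw N \<xi> k \<omega> \<noteq> 0" if "enat k < censored_extinction_time N \<xi> \<omega>"
    using that by (auto simp: not_less[symmetric])
next
  assume "censored_gw N \<xi> k \<omega> \<noteq> 0"
  then have "k < l" if "censored_gw N \<xi> l \<omega> = 0" for l
    using censored_gw_absorbed that by (metis linorder_not_le)
  then have "enat (Suc k) \<le> censored_extinction_time N \<xi> \<omega>"
    unfolding censored_extinction_time_def by (intro Inf_greatest) (auto simp: Suc_le_eq)
  then show "enat k < censored_extinction_time N \<xi> \<omega>"
    by (metis Suc_ile_eq)
qed

context offspring_family
begin

lemma measurable_censored_extinction_time[measurable]: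
  "censored_extinction_time N \<xi> \<in> measurable M (count_space UNIV)"
proof -
  \<comment> \<open>The \<open>LEAST\<close> form reduces measurability to countably many
    events.\<close>
  let ?U = "\<lambda>\<omega>. if \<exists>k. censored_gw N \<xi> k \<omega> = 0 then enat (LEAST k. censored_gw N \<xi> k \<omega> = 0) else \<infinity>"
  have "censored_extinction_time N \<xi> \<omega> = ?U \<omega>" for \<omega>
  proof (cases "\<exists>k. censored_gw N \<xi> k \<omega> = 0")
    case True
    then have "censored_gw N \<xi> (LEAST k. censored_gw N \<xi> k \<omega> = 0) \<omega> = 0"
      by (rule LeastI_ex)
    then have "Inf (enat ` {k. censored_gw N \<xi> k \<omega> = 0}) = enat (LEAST k. censored_gw N \<xi> k \<omega> = 0)"
      by (intro antisym Inf_lower Inf_greatest) (auto simp: Least_le)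
    with True show ?thesis
      by (simp add: censored_extinction_time_def)
  next
    case False
    then have empty: "{k. censored_gw N \<xi> k \<omega> = 0} = {}"
      by auto
    from False show ?thesis
      unfolding censored_extinction_time_def empty by (simp add: top_enat_def)
  qed
  then have "censored_extinction_time N \<xi> = ?U"
    by auto
  moreover have "?U \<in> measurable M (count_space UNIV)"
    by measurable
  ultimately show ?thesis
    by simp
qed

lemma mean_extinction_time_eq:
  "mean_extinction_time M N \<xi> = (\<Sum>k. ennreal (prob {\<omega> \<in> space M. censored_gw N \<xi> k \<omega> \<noteq> 0}))"
  unfolding mean_extinction_time_def
  by (subst nn_integral_enat_function) (simp_all add: less_censored_extinction_time emeasure_eq_measure)

lemma cdf_scaled_extinction_law_neg:
  assumes "0 \<le> q" "t < 0"
  shows "cdf (scaled_extinction_law M N \<xi> q) t = 0"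
proof -
  have "t < enn2real (ennreal_of_enat (censored_extinction_time N \<xi> \<omega>)) * q ^ N" for \<omega>
    using assms by (intro less_le_trans[OF assms(2)]) simp
  then have "(\<lambda>\<omega>. enn2real (ennreal_of_enat (censored_extinction_time N \<xi> \<omega>)) * q ^ N) -` {..t} \<inter> space M = {}"
    by (auto simp: not_le[symmetric])
  then show ?thesis
    unfolding cdf_def scaled_extinction_law_def by (subst measure_distr) auto
qed

text \<open>A finite mean makes the extinction time almost surely finite, so the value 0 that
  \<open>enn2real\<close> gives to \<infinity> matters only on a null set. The floor appears because
  the extinction time is an integer.\<close>

lemma cdf_scaled_extinction_law:
  assumes q: "0 < q" and t: "0 \<le> t" and fin: "mean_extinction_time M N \<xi> < \<infinity>"
  shows "cdf (scaled_extinction_law M N \<xi> q) t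
    = 1 - prob {\<omega> \<in> space M. censored_gw N \<xi> (nat \<lfloor>t / q ^ N\<rfloor>) \<omega> \<noteq> 0}"
proof -
  define V where "V \<omega> = enn2real (ennreal_of_enat (censored_extinction_time N \<xi> \<omega>)) * q ^ N" for \<omega>
  define k where "k = nat \<lfloor>t / q ^ N\<rfloor>"
  have [measurable]: "V \<in> borel_measurable M"
    unfolding V_def by measurable
  have "AE \<omega> in M. ennreal_of_enat (censored_extinction_time N \<xi> \<omega>) \<noteq> \<infinity>"
    using fin unfolding mean_extinction_time_def
    by (intro nn_integral_PInf_AE) auto
  then have "AE \<omega> in M. V \<omega> \<le> t \<longleftrightarrow> censored_gw N \<xi> k \<omega> = 0"
  proof eventually_elim
    case (elim \<omega>)
    then obtain n where n: "censored_extinction_time N \<xi> \<omega> = enat n"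
      by (cases "censored_extinction_time N \<xi> \<omega>") auto
    have "V \<omega> = real n * q ^ N"
      by (simp add: V_def n ennreal_of_nat_eq_real_of_nat)
    then have "V \<omega> \<le> t \<longleftrightarrow> real n \<le> t / q ^ N"
      using q by (simp add: pos_le_divide_eq)
    also have "\<dots> \<longleftrightarrow> n \<le> k"
      using t q by (simp add: k_def le_nat_iff le_floor_iff)
    also have "\<dots> \<longleftrightarrow> \<not> enat k < censored_extinction_time N \<xi> \<omega>"
      by (simp add: n not_less)
    finally show ?case
      by (simp add: less_censored_extinction_time)
  qed
  then have "prob {\<omega> \<in> space M. V \<omega> \<le> t} = prob {\<omega> \<in> space M. \<not> censored_gw N \<xi> k \<omega> \<noteq> 0}"
    by (intro finite_measure_eq_AE) auto
  also have "\<dots> = 1 - prob {\<omega> \<in> space M. censored_gw N \<xi> k \<omega> \<noteq> 0}"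
    by (intro prob_neg) auto
  also have "prob {\<omega> \<in> space M. V \<omega> \<le> t} = cdf (scaled_extinction_law M N \<xi> q) t"
    unfolding cdf_def scaled_extinction_law_def V_def[symmetric]
    by (subst measure_distr) (auto intro!: arg_cong[where f = prob])
  finally show ?thesis
    by (simp add: k_def)
qed

end

section \<open>Convergence in law and in mean\<close>

lemma cdf_exponential_1:
  "cdf (density lborel (exponential_density 1)) t = (if 0 \<le> t then 1 - exp (- t) else 0)"
  \<comment> \<open>The exponential law is the Erlang law of shape 0.\<close>
  unfolding cdf_def measure_def
  by (simp add: emeasure_erlang_density erlang_CDF_0)

theorem theorem1:
  fixes \<X> :: "nat pmf"
    and M\<^sub>Z :: "'v measure" and \<zeta> :: "nat \<Rightarrow> nat \<Rightarrow> 'v \<Rightarrow> nat"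
    and M :: "nat \<Rightarrow> 'w measure" and \<xi> :: "nat \<Rightarrow> nat \<Rightarrow> nat \<Rightarrow> 'w \<Rightarrow> nat"
    and q :: real
  assumes "(\<integral>\<^sup>+ i. of_nat i \<partial>measure_pmf \<X>) > (1 :: ennreal)"
    and "pmf \<X> 0 > 0"
    and "iid_offspring M\<^sub>Z \<X> \<zeta>"
    and "q = extinction_probability M\<^sub>Z \<zeta>"
    and "\<And>N. N \<ge> 2 \<Longrightarrow> iid_offspring (M N) \<X> (\<xi> N)"
  shows "weak_conv_m (\<lambda>N. scaled_extinction_law (M N) N (\<xi> N) q)
           (density lborel (exponential_density 1))
       \<and> (\<lambda>N. ennreal (q ^ N) * mean_extinction_time (M N) N (\<xi> N)) \<longlonglongrightarrow> 1"
proof -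
  have lim: "(\<lambda>k. (pgf \<X> ^^ k) 0) \<longlonglongrightarrow> q"
    unfolding assms(4)
    by (rule offspring_family.tendsto_extinction_probability) (unfold_locales, fact)
  obtain r where r: "0 < r" "r < 1" "pgf \<X> r < r"
    using pgf_less_self[OF assms(1)] .
  have fixed: "pgf \<X> q = q"
    by (rule pgf_limit_fixed[OF lim])
  \<comment> \<open>\<open>q\<close> is a fixed point and \<open>r\<close> is not, so minimality
    gives a strict inequality.\<close>
  have "q \<le> r" "q \<noteq> r"
    using pgf_limit_least[OF lim, of r] r fixed by auto
  then have qr: "q < r"
    by simp
  \<comment> \<open>The first iterate is \<open>pmf \<X> 0\<close>, whence
    \<open>q > 0\<close>.\<close>
  have q: "0 < q" "q < 1"
    using funpow_pgf_le_limit[OF lim, of 1] assms(2) qr r by (auto simp: pgf_0)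
  have fam: "offspring_family (M N) \<X> (\<xi> N)" if "N \<ge> 2" for N
    using assms(5)[OF that] by unfold_locales
  define a where "a N k = measure (M N) {\<omega> \<in> space (M N). censored_gw N (\<xi> N) k \<omega> \<noteq> 0}" for N k
  have y_lim: "(\<lambda>N. q ^ N) \<longlonglongrightarrow> 0"
    using q by (intro LIMSEQ_realpow_zero) auto
  have a01: "\<forall>\<^sub>F N in sequentially. \<forall>k. 0 \<le> a N k \<and> a N k \<le> 1"
    using eventually_ge_at_top[of 2]
  proof eventually_elim
    case (elim N)
    interpret offspring_family "M N" \<X> "\<xi> N"
      using fam elim .
    show ?case
      by (simp add: a_def)
  qed
  have lower: "\<forall>\<^sub>F N in sequentially. \<forall>k. (1 - q ^ N) ^ Suc k \<le> a N k"
    using eventually_ge_at_top[of 2]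
    by eventually_elim (use offspring_family.censored_survival_lower[OF fam q fixed] in \<open>auto simp: a_def\<close>)
  have upper: "\<exists>j. \<forall>\<^sub>F N in sequentially. \<forall>k. a N (k + j) \<le> (1 + e) * (1 - (1 - e) * q ^ N) ^ k"
    if "0 < e" "e < 1" for e
    unfolding a_def using censored_survival_upper[OF fam lim q qr r(2,3) that] .
  note limits = geometric_tail_limits[of "\<lambda>N. q ^ N" a, OF _ y_lim a01 lower upper]
  have mean_eq: "\<forall>\<^sub>F N in sequentially. (\<Sum>k. ennreal (a N k)) = mean_extinction_time (M N) N (\<xi> N)"
    using eventually_ge_at_top[of 2]
    by eventually_elim (use offspring_family.mean_extinction_time_eq[OF fam] in \<open>auto simp: a_def\<close>)
  have "(\<lambda>N. ennreal (q ^ N) * (\<Sum>k. ennreal (a N k))) \<longlonglongrightarrow> 1"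
    using limits(2) q by auto
  then have mean: "(\<lambda>N. ennreal (q ^ N) * mean_extinction_time (M N) N (\<xi> N)) \<longlonglongrightarrow> 1"
    by (rule Lim_transform_eventually) (use mean_eq in \<open>auto elim: eventually_mono\<close>)
  \<comment> \<open>The mean comes first: its limit makes it finite for large \<open>N\<close>, as
    the formula for the distribution function requires.\<close>
  then have "\<forall>\<^sub>F N in sequentially. ennreal (q ^ N) * mean_extinction_time (M N) N (\<xi> N) < 2"
    by (rule order_tendstoD) simp
  then have fin: "\<forall>\<^sub>F N in sequentially. mean_extinction_time (M N) N (\<xi> N) < \<infinity>"
  proof eventually_elim
    case (elim N)
    then show ?case
      using q by (cases "mean_extinction_time (M N) N (\<xi> N)") (auto simp: ennreal_mult_top)
  qed
  \<comment> \<open>The limit distribution function is continuous, so convergence is shown at every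
    \<open>t\<close>.\<close>
  have "(\<lambda>N. cdf (scaled_extinction_law (M N) N (\<xi> N) q) t)
      \<longlonglongrightarrow> cdf (density lborel (exponential_density 1)) t" for t
  proof (cases "0 \<le> t")
    case True
    have "(\<lambda>N. 1 - a N (nat \<lfloor>t / q ^ N\<rfloor>)) \<longlonglongrightarrow> 1 - exp (- t)"
      using limits(1)[of t] True q by (intro tendsto_intros) auto
    moreover have "\<forall>\<^sub>F N in sequentially.
        1 - a N (nat \<lfloor>t / q ^ N\<rfloor>) = cdf (scaled_extinction_law (M N) N (\<xi> N) q) t"
      using fin eventually_ge_at_top[of 2]
      by eventually_elim
         (use offspring_family.cdf_scaled_extinction_law[OF fam q(1) True] in \<open>auto simp: a_def\<close>)
    ultimately show ?thesis
      using True by (simp add: cdf_exponential_1 Lim_transform_eventually)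
  next
    case False
    have "\<forall>\<^sub>F N in sequentially. 0 = cdf (scaled_extinction_law (M N) N (\<xi> N) q) t"
      using eventually_ge_at_top[of 2]
      by eventually_elim
         (use offspring_family.cdf_scaled_extinction_law_neg[OF fam, of _ q t] False q in auto)
    then have "(\<lambda>N. cdf (scaled_extinction_law (M N) N (\<xi> N) q) t) \<longlonglongrightarrow> 0"
      by (rule Lim_transform_eventually[OF tendsto_const])
    then show ?thesis
      using False by (simp add: cdf_exponential_1)
  qed
  then show ?thesis
    using mean by (simp add: weak_conv_m_def weak_conv_def)
qed

end
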